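(* Let $U$ be an update statement, $\sigma$ a valuation, $\Delta$ a database instance with $[\![U]\!]_{\sigma,\Delta}=\Delta'$, and $\Phi$ a $\mathcal{T}_{RA}$ formula. If $(\Delta,\sigma)\sim\Phi$, then $(\Delta',\sigma)\sim\mathit{sp}(\Phi,U)$.
   Context: Update statements over a schema $\mathcal{S}$ (a map from relation names $R$ to attribute lists $a_1,\dots,a_n$) are $U ::= \mathtt{ins}(R,\{a_1:v_1,\dots,a_n:v_n\}) \mid \mathtt{del}(R,\phi)\mid \mathtt{upd}(R,\phi,a,v)\mid U;U$, queries are $Q ::= R\mid \Pi_\psi(Q)\mid \sigma_\phi(Q)\mid Q\bowtie_\phi Q\mid Q\cup Q\mid Q-Q$, and predicates $\phi$ are boolean combinations of atoms $a\odot a'$, $a\odot v$, $a\in Q$ ($\odot\in\{\le,<,=,\ne,>,\ge\}$, $v$ a parameter variable or constant). A database instance $\Delta$ maps relation names to finite lists of tuples (maps from attributes to values); a valuation $\sigma$ maps variables to values. Semantics: $[\![U_1;U_2]\!]_{\sigma,\Delta}=[\![U_2]\!]_{\sigma,[\![U_1]\!]_{\sigma,\Delta}}$; $\mathtt{ins}(R,t)$ appends $t[\sigma]$ at the end of $\Delta(R)$; $\mathtt{del}(R,\phi)$ keeps (in order) the tuples $x$ of $\Delta(R)$ with $[\![\phi]\!]_{\sigma,\Delta,x}$ false; $\mathtt{upd}(R,\phi,a,v)$ sets $\Delta(R)$ to the tuples not satisfying $\phi$ (in order) followed by the tuples satisfying $\phi$ (in order) with attribute $a$ set to $v[\sigma]$.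 Queries: $R$ gives $\Delta(R)$; $\Pi_\psi$ restricts tuples to attributes in $\psi$; $\sigma_\phi$ filters; $\times$ lists merged pairs $y\cup z$ for $y$ in the first and $z$ in the second (nested, in order); $\bowtie_\phi=\sigma_\phi\circ\times$; $\cup$ concatenates; $Q_1-Q_2$ deletes from $[\![Q_1]\!]$ the first occurrence of each element of $[\![Q_2]\!]$ in turn. Predicate $[\![\phi]\!]_{\sigma,\Delta,x}$ on tuple $x$: comparisons of $x(a)$ with $x(a')$ or $v[\sigma]$; $a\in Q$ iff $x(a)$ occurs among the first values of the tuples of $[\![Q]\!]_{\sigma,\Delta}$. Theory $\mathcal{T}_{RA}$ (relational algebra with updates): terms $t ::= x\mid T\mid \Pi_{a_{i_1},\dots,a_{i_k}}(t)\mid \sigma_\phi(t)\mid t\times t\mid t\cup t\mid t-t\mid t\langle a_i\leftarrow v\rangle$ ($x$ variables, $T$ table symbols), predicates $\phi ::= a_i\odot a_j\mid a_i\odot v\mid a_i\in t\mid\phi\wedge\phi\mid\phi\vee\phi\mid\neg\phi$, formulas are first-order ($\mathit{true},\mathit{false}$, $t=t$, $\wedge,\vee,\neg,\to,\exists,\forall$). Relation terms denote finite lists of rows, each row a finite list of values; $a_i$ refers to the $i$-th component of a row. $\Pi$ keeps in each row the listed components; $\sigma_\phi$ keeps rows satisfying $\phi$ ($a_i\in t$: the $i$-th component occurs among the first components of the rows of $t$); $t_1\times t_2$ lists, for each row $y$ of $t_1$ and then each row $z$ of $t_2$, the concatenation $y{+}{+}z$; $\cup$ is concatenation; $t_1-t_2$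 deletes from $t_1$ the first occurrence of each row of $t_2$ in turn; $t\langle a_i\leftarrow v\rangle$ replaces the $i$-th component of every row by the value of $v$. $\varsigma$ translates program syntax to $\mathcal{T}_{RA}$ by replacing each attribute name by $a_i$ with $i$ its position; $\varsigma(\Delta)$ interprets each relation symbol $R$ as the list of rows $[v_1,\dots,v_n]$ obtained from the tuples $\{a_1:v_1,\dots,a_n:v_n\}$ of $\Delta(R)$ (attributes in schema order). Agreement: $(\Delta,\sigma)\sim\Phi$ iff $\varsigma(\Delta)\uplus\sigma\models\Phi$. Strongest postcondition: $\mathit{sp}(\Phi,\mathtt{ins}(R,\{a_1:v_1,\dots,a_n:v_n\}))=\exists x.\,(R=x\cup[[v_1,\dots,v_n]])\wedge\Phi[x/R]$; $\mathit{sp}(\Phi,\mathtt{del}(R,\phi))=\exists x.\,(R=\sigma_{\varsigma(\neg\phi)}(x))\wedge\Phi[x/R]$; $\mathit{sp}(\Phi,\mathtt{upd}(R,\phi,a,v))=\exists x.\,(R=\sigma_{\varsigma(\neg\phi)}(x)\cup\sigma_{\varsigma(\phi)}(x)\langle\varsigma(a)\leftarrow v\rangle)\wedge\Phi[x/R]$; $\mathit{sp}(\Phi,U_1;U_2)=\mathit{sp}(\mathit{sp}(\Phi,U_1),U_2)$. Here $\Phi[x/R]$ substitutes the fresh variable $x$ for $R$.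
   Formalization: In sp of del and upd, x also replaces R inside the translated predicate, since the displayed clauses fail for del(R, a∈R); statements and instances are assumed well-typed over the schema (join sides share no attribute, union and difference sides have the same attribute list). *)

theory Defs
  imports Main
begin

section \<open>Database programs\<close>

text \<open>The type variables \<open>'r\<close>, \<open>'a\<close>, \<open>'p\<close> and \<open>'v\<close> stand for relation names, attribute
  names, parameter variables and values; a schema is a function \<open>'r \<Rightarrow> 'a list\<close>.\<close>

datatype ('p, 'v) vexp = Param 'p | Const 'v

primrec veval :: "('p \<Rightarrow> 'v) \<Rightarrow> ('p, 'v) vexp \<Rightarrow> 'v" where
  "veval \<sigma> (Param p) = \<sigma> p"
| "veval \<sigma> (Const c) = c"

datatype cmp = Le | Lt | Eq | Ne | Gt | Ge

primrec cmp_sem :: "cmp \<Rightarrow> 'v::linorder \<Rightarrow> 'v \<Rightarrow> bool" where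
  "cmp_sem Le u v = (u \<le> v)"
| "cmp_sem Lt u v = (u < v)"
| "cmp_sem Eq u v = (u = v)"
| "cmp_sem Ne u v = (u \<noteq> v)"
| "cmp_sem Gt u v = (u > v)"
| "cmp_sem Ge u v = (u \<ge> v)"

datatype (query_rels: 'r, 'a, 'p, 'v) query =
    QRel 'r
  | QProj "'a list" "('r, 'a, 'p, 'v) query"
  | QSel "('r, 'a, 'p, 'v) pred" "('r, 'a, 'p, 'v) query"
  | QJoin "('r, 'a, 'p, 'v) pred" "('r, 'a, 'p, 'v) query" "('r, 'a, 'p, 'v) query"
  | QUnion "('r, 'a, 'p, 'v) query" "('r, 'a, 'p, 'v) query"
  | QDiff "('r, 'a, 'p, 'v) query" "('r, 'a, 'p, 'v) query"
and (pred_rels: 'r, 'a, 'p, 'v) pred =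
    PAttr cmp 'a 'a
  | PVal cmp 'a "('p, 'v) vexp"
  | PIn 'a "('r, 'a, 'p, 'v) query"
  | PAnd "('r, 'a, 'p, 'v) pred" "('r, 'a, 'p, 'v) pred"
  | POr "('r, 'a, 'p, 'v) pred" "('r, 'a, 'p, 'v) pred"
  | PNot "('r, 'a, 'p, 'v) pred"

datatype ('r, 'a, 'p, 'v) update =
    Ins 'r "('a \<times> ('p, 'v) vexp) list"
  | Del 'r "('r, 'a, 'p, 'v) pred"
  | Upd 'r "('r, 'a, 'p, 'v) pred" 'a "('p, 'v) vexp"
  | Seq "('r, 'a, 'p, 'v) update" "('r, 'a, 'p, 'v) update"

type_synonym ('a, 'v) tuple = "'a \<rightharpoonup> 'v"
type_synonym ('r, 'a, 'v) db = "'r \<Rightarrow> ('a, 'v) tuple list"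

text \<open>The ordered list of attributes of the tuples that a query returns. Tuples are unordered
  maps, so this list is what fixes the ``first value'' of a tuple and the positions of
  attributes.\<close>

primrec query_attrs :: "('r \<Rightarrow> 'a list) \<Rightarrow> ('r, 'a, 'p, 'v) query \<Rightarrow> 'a list" where
  "query_attrs S (QRel R) = S R"
| "query_attrs S (QProj \<psi> Q) = \<psi>"
| "query_attrs S (QSel \<phi> Q) = query_attrs S Q"
| "query_attrs S (QJoin \<phi> Q1 Q2) = query_attrs S Q1 @ query_attrs S Q2"
| "query_attrs S (QUnion Q1 Q2) = query_attrs S Q1"
| "query_attrs S (QDiff Q1 Q2) = query_attrs S Q1"

definition row_of :: "'a list \<Rightarrow> ('a, 'v) tuple \<Rightarrow> 'v list" where
  "row_of as t = map (\<lambda>a. the (t a)) as"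

definition first_values :: "'v list list \<Rightarrow> 'v set" where
  "first_values rows = {hd r | r. r \<in> set rows \<and> r \<noteq> []}"

definition list_diff :: "'b list \<Rightarrow> 'b list \<Rightarrow> 'b list" where
  "list_diff xs ys = fold remove1 ys xs"

primrec query_sem ::
    "('r \<Rightarrow> 'a list) \<Rightarrow> ('p \<Rightarrow> 'v::linorder) \<Rightarrow> ('r, 'a, 'v) db \<Rightarrow>
     ('r, 'a, 'p, 'v) query \<Rightarrow> ('a, 'v) tuple list"
and pred_sem ::
    "('r \<Rightarrow> 'a list) \<Rightarrow> ('p \<Rightarrow> 'v::linorder) \<Rightarrow> ('r, 'a, 'v) db \<Rightarrow>
     ('r, 'a, 'p, 'v) pred \<Rightarrow> ('a, 'v) tuple \<Rightarrow> bool" where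
  "query_sem S \<sigma> \<Delta> (QRel R) = \<Delta> R"
| "query_sem S \<sigma> \<Delta> (QProj \<psi> Q) = map (\<lambda>x. x |` set \<psi>) (query_sem S \<sigma> \<Delta> Q)"
| "query_sem S \<sigma> \<Delta> (QSel \<phi> Q) = filter (pred_sem S \<sigma> \<Delta> \<phi>) (query_sem S \<sigma> \<Delta> Q)"
| "query_sem S \<sigma> \<Delta> (QJoin \<phi> Q1 Q2) =
     filter (pred_sem S \<sigma> \<Delta> \<phi>)
       [y ++ z. y \<leftarrow> query_sem S \<sigma> \<Delta> Q1, z \<leftarrow> query_sem S \<sigma> \<Delta> Q2]"
| "query_sem S \<sigma> \<Delta> (QUnion Q1 Q2) = query_sem S \<sigma> \<Delta> Q1 @ query_sem S \<sigma> \<Delta> Q2"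
| "query_sem S \<sigma> \<Delta> (QDiff Q1 Q2) = list_diff (query_sem S \<sigma> \<Delta> Q1) (query_sem S \<sigma> \<Delta> Q2)"
| "pred_sem S \<sigma> \<Delta> (PAttr c a b) = (\<lambda>x. cmp_sem c (the (x a)) (the (x b)))"
| "pred_sem S \<sigma> \<Delta> (PVal c a v) = (\<lambda>x. cmp_sem c (the (x a)) (veval \<sigma> v))"
| "pred_sem S \<sigma> \<Delta> (PIn a Q) =
     (\<lambda>x. the (x a) \<in> first_values (map (row_of (query_attrs S Q)) (query_sem S \<sigma> \<Delta> Q)))"
| "pred_sem S \<sigma> \<Delta> (PAnd \<phi>1 \<phi>2) = (\<lambda>x. pred_sem S \<sigma> \<Delta> \<phi>1 x \<and> pred_sem S \<sigma> \<Delta> \<phi>2 x)"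
| "pred_sem S \<sigma> \<Delta> (POr \<phi>1 \<phi>2) = (\<lambda>x. pred_sem S \<sigma> \<Delta> \<phi>1 x \<or> pred_sem S \<sigma> \<Delta> \<phi>2 x)"
| "pred_sem S \<sigma> \<Delta> (PNot \<phi>) = (\<lambda>x. \<not> pred_sem S \<sigma> \<Delta> \<phi> x)"

primrec update_sem ::
    "('r \<Rightarrow> 'a list) \<Rightarrow> ('p \<Rightarrow> 'v::linorder) \<Rightarrow> ('r, 'a, 'p, 'v) update \<Rightarrow>
     ('r, 'a, 'v) db \<Rightarrow> ('r, 'a, 'v) db" where
  "update_sem S \<sigma> (Ins R avs) \<Delta> =
     \<Delta>(R := \<Delta> R @ [map_of (map (\<lambda>(a, v). (a, veval \<sigma> v)) avs)])"
| "update_sem S \<sigma> (Del R \<phi>) \<Delta> = \<Delta>(R := filter (\<lambda>x. \<not> pred_sem S \<sigma> \<Delta> \<phi> x) (\<Delta> R))"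
| "update_sem S \<sigma> (Upd R \<phi> a v) \<Delta> =
     \<Delta>(R := filter (\<lambda>x. \<not> pred_sem S \<sigma> \<Delta> \<phi> x) (\<Delta> R) @
            map (\<lambda>x. x(a \<mapsto> veval \<sigma> v)) (filter (pred_sem S \<sigma> \<Delta> \<phi>) (\<Delta> R)))"
| "update_sem S \<sigma> (Seq U1 U2) \<Delta> = update_sem S \<sigma> U2 (update_sem S \<sigma> U1 \<Delta>)"

subsection \<open>Programs and instances over a schema\<close>

definition wf_schema :: "('r \<Rightarrow> 'a list) \<Rightarrow> bool" where
  "wf_schema S \<longleftrightarrow> (\<forall>R. distinct (S R))"

definition wf_instance :: "('r \<Rightarrow> 'a list) \<Rightarrow> ('r, 'a, 'v) db \<Rightarrow> bool" where
  "wf_instance S \<Delta> \<longleftrightarrow> (\<forall>R. \<forall>t \<in> set (\<Delta> R). dom t = set (S R))"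

text \<open>The list argument of \<open>wf_pred\<close> is the attribute list of the tuples on which the predicate
  is evaluated. The two sides of a join have no attribute in common (otherwise merging two
  tuples would lose a component), and the two sides of a union or difference have the same
  attribute list.\<close>

primrec wf_query :: "('r \<Rightarrow> 'a list) \<Rightarrow> ('r, 'a, 'p, 'v) query \<Rightarrow> bool"
and wf_pred :: "('r \<Rightarrow> 'a list) \<Rightarrow> ('r, 'a, 'p, 'v) pred \<Rightarrow> 'a list \<Rightarrow> bool" where
  "wf_query S (QRel R) = True"
| "wf_query S (QProj \<psi> Q) = (wf_query S Q \<and> set \<psi> \<subseteq> set (query_attrs S Q))"
| "wf_query S (QSel \<phi> Q) = (wf_query S Q \<and> wf_pred S \<phi> (query_attrs S Q))"
| "wf_query S (QJoin \<phi> Q1 Q2) =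
     (wf_query S Q1 \<and> wf_query S Q2 \<and> set (query_attrs S Q1) \<inter> set (query_attrs S Q2) = {} \<and>
      wf_pred S \<phi> (query_attrs S Q1 @ query_attrs S Q2))"
| "wf_query S (QUnion Q1 Q2) =
     (wf_query S Q1 \<and> wf_query S Q2 \<and> query_attrs S Q1 = query_attrs S Q2)"
| "wf_query S (QDiff Q1 Q2) =
     (wf_query S Q1 \<and> wf_query S Q2 \<and> query_attrs S Q1 = query_attrs S Q2)"
| "wf_pred S (PAttr c a b) = (\<lambda>as. a \<in> set as \<and> b \<in> set as)"
| "wf_pred S (PVal c a v) = (\<lambda>as. a \<in> set as)"
| "wf_pred S (PIn a Q) = (\<lambda>as. a \<in> set as \<and> wf_query S Q)"
| "wf_pred S (PAnd \<phi>1 \<phi>2) = (\<lambda>as. wf_pred S \<phi>1 as \<and> wf_pred S \<phi>2 as)"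
| "wf_pred S (POr \<phi>1 \<phi>2) = (\<lambda>as. wf_pred S \<phi>1 as \<and> wf_pred S \<phi>2 as)"
| "wf_pred S (PNot \<phi>) = (\<lambda>as. wf_pred S \<phi> as)"

primrec wf_update :: "('r \<Rightarrow> 'a list) \<Rightarrow> ('r, 'a, 'p, 'v) update \<Rightarrow> bool" where
  "wf_update S (Ins R avs) = (map fst avs = S R)"
| "wf_update S (Del R \<phi>) = wf_pred S \<phi> (S R)"
| "wf_update S (Upd R \<phi> a v) = (wf_pred S \<phi> (S R) \<and> a \<in> set (S R))"
| "wf_update S (Seq U1 U2) = (wf_update S U1 \<and> wf_update S U2)"

section \<open>The theory of relational algebra with updates\<close>

text \<open>Relation variables are natural numbers, so fresh ones exist. Components of rows are counted
  from 0. \<open>TRow [v\<^sub>1, \<dots>, v\<^sub>n]\<close> is the one-row relation \<open>[[v\<^sub>1, \<dots>, v\<^sub>n]]\<close> that occurs in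
  the strongest postcondition of an insertion.\<close>

datatype (tm_tabs: 'r, 'p, 'v) tm =
    TVar nat
  | TTab 'r
  | TRow "('p, 'v) vexp list"
  | TProj "nat list" "('r, 'p, 'v) tm"
  | TSel "('r, 'p, 'v) tpred" "('r, 'p, 'v) tm"
  | TProd "('r, 'p, 'v) tm" "('r, 'p, 'v) tm"
  | TUnion "('r, 'p, 'v) tm" "('r, 'p, 'v) tm"
  | TDiff "('r, 'p, 'v) tm" "('r, 'p, 'v) tm"
  | TUpd "('r, 'p, 'v) tm" nat "('p, 'v) vexp"
and (tpred_tabs: 'r, 'p, 'v) tpred =
    TPAttr cmp nat nat
  | TPVal cmp nat "('p, 'v) vexp"
  | TPIn nat "('r, 'p, 'v) tm"
  | TPAnd "('r, 'p, 'v) tpred" "('r, 'p, 'v) tpred"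
  | TPOr "('r, 'p, 'v) tpred" "('r, 'p, 'v) tpred"
  | TPNot "('r, 'p, 'v) tpred"

text \<open>Formulas are two-sorted: \<open>FEx\<close> and \<open>FAll\<close> bind relation variables, \<open>FExV\<close> and \<open>FAllV\<close>
  bind value variables.\<close>

datatype ('r, 'p, 'v) fm =
    FTrue
  | FFalse
  | FEq "('r, 'p, 'v) tm" "('r, 'p, 'v) tm"
  | FAnd "('r, 'p, 'v) fm" "('r, 'p, 'v) fm"
  | FOr "('r, 'p, 'v) fm" "('r, 'p, 'v) fm"
  | FNot "('r, 'p, 'v) fm"
  | FImp "('r, 'p, 'v) fm" "('r, 'p, 'v) fm"
  | FEx nat "('r, 'p, 'v) fm"
  | FAll nat "('r, 'p, 'v) fm"
  | FExV 'p "('r, 'p, 'v) fm"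
  | FAllV 'p "('r, 'p, 'v) fm"

primrec tm_sem ::
    "('r \<Rightarrow> 'v::linorder list list) \<Rightarrow> ('p \<Rightarrow> 'v) \<Rightarrow> (nat \<Rightarrow> 'v list list) \<Rightarrow>
     ('r, 'p, 'v) tm \<Rightarrow> 'v list list"
and tpred_sem ::
    "('r \<Rightarrow> 'v::linorder list list) \<Rightarrow> ('p \<Rightarrow> 'v) \<Rightarrow> (nat \<Rightarrow> 'v list list) \<Rightarrow>
     ('r, 'p, 'v) tpred \<Rightarrow> 'v list \<Rightarrow> bool" where
  "tm_sem I \<sigma> \<rho> (TVar x) = \<rho> x"
| "tm_sem I \<sigma> \<rho> (TTab T) = I T"
| "tm_sem I \<sigma> \<rho> (TRow vs) = [map (veval \<sigma>) vs]"
| "tm_sem I \<sigma> \<rho> (TProj is t) = map (\<lambda>r. map (\<lambda>i. r ! i) is) (tm_sem I \<sigma> \<rho> t)"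
| "tm_sem I \<sigma> \<rho> (TSel \<phi> t) = filter (tpred_sem I \<sigma> \<rho> \<phi>) (tm_sem I \<sigma> \<rho> t)"
| "tm_sem I \<sigma> \<rho> (TProd t1 t2) = [y @ z. y \<leftarrow> tm_sem I \<sigma> \<rho> t1, z \<leftarrow> tm_sem I \<sigma> \<rho> t2]"
| "tm_sem I \<sigma> \<rho> (TUnion t1 t2) = tm_sem I \<sigma> \<rho> t1 @ tm_sem I \<sigma> \<rho> t2"
| "tm_sem I \<sigma> \<rho> (TDiff t1 t2) = list_diff (tm_sem I \<sigma> \<rho> t1) (tm_sem I \<sigma> \<rho> t2)"
| "tm_sem I \<sigma> \<rho> (TUpd t i v) = map (\<lambda>r. r[i := veval \<sigma> v]) (tm_sem I \<sigma> \<rho> t)"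
| "tpred_sem I \<sigma> \<rho> (TPAttr c i j) = (\<lambda>r. cmp_sem c (r ! i) (r ! j))"
| "tpred_sem I \<sigma> \<rho> (TPVal c i v) = (\<lambda>r. cmp_sem c (r ! i) (veval \<sigma> v))"
| "tpred_sem I \<sigma> \<rho> (TPIn i t) = (\<lambda>r. r ! i \<in> first_values (tm_sem I \<sigma> \<rho> t))"
| "tpred_sem I \<sigma> \<rho> (TPAnd \<phi>1 \<phi>2) = (\<lambda>r. tpred_sem I \<sigma> \<rho> \<phi>1 r \<and> tpred_sem I \<sigma> \<rho> \<phi>2 r)"
| "tpred_sem I \<sigma> \<rho> (TPOr \<phi>1 \<phi>2) = (\<lambda>r. tpred_sem I \<sigma> \<rho> \<phi>1 r \<or> tpred_sem I \<sigma> \<rho> \<phi>2 r)"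
| "tpred_sem I \<sigma> \<rho> (TPNot \<phi>) = (\<lambda>r. \<not> tpred_sem I \<sigma> \<rho> \<phi> r)"

primrec sat ::
    "('r \<Rightarrow> 'v::linorder list list) \<Rightarrow> ('p \<Rightarrow> 'v) \<Rightarrow> (nat \<Rightarrow> 'v list list) \<Rightarrow>
     ('r, 'p, 'v) fm \<Rightarrow> bool" where
  "sat I \<sigma> \<rho> FTrue = True"
| "sat I \<sigma> \<rho> FFalse = False"
| "sat I \<sigma> \<rho> (FEq t1 t2) = (tm_sem I \<sigma> \<rho> t1 = tm_sem I \<sigma> \<rho> t2)"
| "sat I \<sigma> \<rho> (FAnd F G) = (sat I \<sigma> \<rho> F \<and> sat I \<sigma> \<rho> G)"
| "sat I \<sigma> \<rho> (FOr F G) = (sat I \<sigma> \<rho> F \<or> sat I \<sigma> \<rho> G)"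
| "sat I \<sigma> \<rho> (FNot F) = (\<not> sat I \<sigma> \<rho> F)"
| "sat I \<sigma> \<rho> (FImp F G) = (sat I \<sigma> \<rho> F \<longrightarrow> sat I \<sigma> \<rho> G)"
| "sat I \<sigma> \<rho> (FEx x F) = (\<exists>r. sat I \<sigma> (\<rho>(x := r)) F)"
| "sat I \<sigma> \<rho> (FAll x F) = (\<forall>r. sat I \<sigma> (\<rho>(x := r)) F)"
| "sat I \<sigma> \<rho> (FExV p F) = (\<exists>v. sat I (\<sigma>(p := v)) \<rho> F)"
| "sat I \<sigma> \<rho> (FAllV p F) = (\<forall>v. sat I (\<sigma>(p := v)) \<rho> F)"

primrec tm_vars :: "('r, 'p, 'v) tm \<Rightarrow> nat set"
and tpred_vars :: "('r, 'p, 'v) tpred \<Rightarrow> nat set" where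
  "tm_vars (TVar x) = {x}"
| "tm_vars (TTab T) = {}"
| "tm_vars (TRow vs) = {}"
| "tm_vars (TProj is t) = tm_vars t"
| "tm_vars (TSel \<phi> t) = tpred_vars \<phi> \<union> tm_vars t"
| "tm_vars (TProd t1 t2) = tm_vars t1 \<union> tm_vars t2"
| "tm_vars (TUnion t1 t2) = tm_vars t1 \<union> tm_vars t2"
| "tm_vars (TDiff t1 t2) = tm_vars t1 \<union> tm_vars t2"
| "tm_vars (TUpd t i v) = tm_vars t"
| "tpred_vars (TPAttr c i j) = {}"
| "tpred_vars (TPVal c i v) = {}"
| "tpred_vars (TPIn i t) = tm_vars t"
| "tpred_vars (TPAnd \<phi>1 \<phi>2) = tpred_vars \<phi>1 \<union> tpred_vars \<phi>2"
| "tpred_vars (TPOr \<phi>1 \<phi>2) = tpred_vars \<phi>1 \<union> tpred_vars \<phi>2"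
| "tpred_vars (TPNot \<phi>) = tpred_vars \<phi>"

text \<open>All relation variables of a formula, free or bound; a variable outside this set can be
  substituted for a table symbol without capture.\<close>

primrec fm_vars :: "('r, 'p, 'v) fm \<Rightarrow> nat set" where
  "fm_vars FTrue = {}"
| "fm_vars FFalse = {}"
| "fm_vars (FEq t1 t2) = tm_vars t1 \<union> tm_vars t2"
| "fm_vars (FAnd F G) = fm_vars F \<union> fm_vars G"
| "fm_vars (FOr F G) = fm_vars F \<union> fm_vars G"
| "fm_vars (FNot F) = fm_vars F"
| "fm_vars (FImp F G) = fm_vars F \<union> fm_vars G"
| "fm_vars (FEx x F) = insert x (fm_vars F)"
| "fm_vars (FAll x F) = insert x (fm_vars F)"
| "fm_vars (FExV p F) = fm_vars F"
| "fm_vars (FAllV p F) = fm_vars F"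

definition fresh_var :: "('r, 'p, 'v) fm \<Rightarrow> nat" where
  "fresh_var F = (SOME x. x \<notin> fm_vars F)"

primrec tm_subst :: "nat \<Rightarrow> 'r \<Rightarrow> ('r, 'p, 'v) tm \<Rightarrow> ('r, 'p, 'v) tm"
and tpred_subst :: "nat \<Rightarrow> 'r \<Rightarrow> ('r, 'p, 'v) tpred \<Rightarrow> ('r, 'p, 'v) tpred" where
  "tm_subst x R (TVar y) = TVar y"
| "tm_subst x R (TTab T) = (if T = R then TVar x else TTab T)"
| "tm_subst x R (TRow vs) = TRow vs"
| "tm_subst x R (TProj is t) = TProj is (tm_subst x R t)"
| "tm_subst x R (TSel \<phi> t) = TSel (tpred_subst x R \<phi>) (tm_subst x R t)"
| "tm_subst x R (TProd t1 t2) = TProd (tm_subst x R t1) (tm_subst x R t2)"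
| "tm_subst x R (TUnion t1 t2) = TUnion (tm_subst x R t1) (tm_subst x R t2)"
| "tm_subst x R (TDiff t1 t2) = TDiff (tm_subst x R t1) (tm_subst x R t2)"
| "tm_subst x R (TUpd t i v) = TUpd (tm_subst x R t) i v"
| "tpred_subst x R (TPAttr c i j) = TPAttr c i j"
| "tpred_subst x R (TPVal c i v) = TPVal c i v"
| "tpred_subst x R (TPIn i t) = TPIn i (tm_subst x R t)"
| "tpred_subst x R (TPAnd \<phi>1 \<phi>2) = TPAnd (tpred_subst x R \<phi>1) (tpred_subst x R \<phi>2)"
| "tpred_subst x R (TPOr \<phi>1 \<phi>2) = TPOr (tpred_subst x R \<phi>1) (tpred_subst x R \<phi>2)"
| "tpred_subst x R (TPNot \<phi>) = TPNot (tpred_subst x R \<phi>)"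

primrec fm_subst :: "nat \<Rightarrow> 'r \<Rightarrow> ('r, 'p, 'v) fm \<Rightarrow> ('r, 'p, 'v) fm" where
  "fm_subst x R FTrue = FTrue"
| "fm_subst x R FFalse = FFalse"
| "fm_subst x R (FEq t1 t2) = FEq (tm_subst x R t1) (tm_subst x R t2)"
| "fm_subst x R (FAnd F G) = FAnd (fm_subst x R F) (fm_subst x R G)"
| "fm_subst x R (FOr F G) = FOr (fm_subst x R F) (fm_subst x R G)"
| "fm_subst x R (FNot F) = FNot (fm_subst x R F)"
| "fm_subst x R (FImp F G) = FImp (fm_subst x R F) (fm_subst x R G)"
| "fm_subst x R (FEx y F) = FEx y (fm_subst x R F)"
| "fm_subst x R (FAll y F) = FAll y (fm_subst x R F)"
| "fm_subst x R (FExV p F) = FExV p (fm_subst x R F)"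
| "fm_subst x R (FAllV p F) = FAllV p (fm_subst x R F)"

section \<open>Translation and agreement\<close>

definition pos :: "'a list \<Rightarrow> 'a \<Rightarrow> nat" where
  "pos as a = length (takeWhile (\<lambda>b. b \<noteq> a) as)"

primrec tr_query :: "('r \<Rightarrow> 'a list) \<Rightarrow> ('r, 'a, 'p, 'v) query \<Rightarrow> ('r, 'p, 'v) tm"
and tr_pred :: "('r \<Rightarrow> 'a list) \<Rightarrow> ('r, 'a, 'p, 'v) pred \<Rightarrow> 'a list \<Rightarrow> ('r, 'p, 'v) tpred" where
  "tr_query S (QRel R) = TTab R"
| "tr_query S (QProj \<psi> Q) = TProj (map (pos (query_attrs S Q)) \<psi>) (tr_query S Q)"
| "tr_query S (QSel \<phi> Q) = TSel (tr_pred S \<phi> (query_attrs S Q)) (tr_query S Q)"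
| "tr_query S (QJoin \<phi> Q1 Q2) =
     TSel (tr_pred S \<phi> (query_attrs S Q1 @ query_attrs S Q2))
       (TProd (tr_query S Q1) (tr_query S Q2))"
| "tr_query S (QUnion Q1 Q2) = TUnion (tr_query S Q1) (tr_query S Q2)"
| "tr_query S (QDiff Q1 Q2) = TDiff (tr_query S Q1) (tr_query S Q2)"
| "tr_pred S (PAttr c a b) = (\<lambda>as. TPAttr c (pos as a) (pos as b))"
| "tr_pred S (PVal c a v) = (\<lambda>as. TPVal c (pos as a) v)"
| "tr_pred S (PIn a Q) = (\<lambda>as. TPIn (pos as a) (tr_query S Q))"
| "tr_pred S (PAnd \<phi>1 \<phi>2) = (\<lambda>as. TPAnd (tr_pred S \<phi>1 as) (tr_pred S \<phi>2 as))"
| "tr_pred S (POr \<phi>1 \<phi>2) = (\<lambda>as. TPOr (tr_pred S \<phi>1 as) (tr_pred S \<phi>2 as))"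
| "tr_pred S (PNot \<phi>) = (\<lambda>as. TPNot (tr_pred S \<phi> as))"

definition tr_instance ::
    "('r \<Rightarrow> 'a list) \<Rightarrow> ('r, 'a, 'v) db \<Rightarrow> 'r \<Rightarrow> 'v list list" where
  "tr_instance S \<Delta> R = map (row_of (S R)) (\<Delta> R)"

text \<open>The structure given by an instance and a valuation interprets table symbols and value
  variables; as usual for truth of a formula in a structure, free relation variables are read
  universally.\<close>

definition agrees ::
    "('r \<Rightarrow> 'a list) \<Rightarrow> ('r, 'a, 'v::linorder) db \<Rightarrow> ('p \<Rightarrow> 'v) \<Rightarrow>
     ('r, 'p, 'v) fm \<Rightarrow> bool" where
  "agrees S \<Delta> \<sigma> \<Phi> \<longleftrightarrow> (\<forall>\<rho>. sat (tr_instance S \<Delta>) \<sigma> \<rho> \<Phi>)"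

section \<open>Strongest postcondition\<close>

text \<open>The predicate of a deletion or update is evaluated in the state before the statement.
  Hence, if a subquery of the predicate mentions the modified relation \<open>R\<close>, that occurrence also
  denotes the old content \<open>x\<close> of \<open>R\<close>, and the substitution of \<open>x\<close> for \<open>R\<close> applies to the
  translated predicate as well. It is the identity unless the predicate mentions \<open>R\<close>
  (lemma \<open>sp_eq_sp_unsubst\<close>); without it the postcondition is unsound
  (lemma \<open>sp_unsubst_unsound\<close>).\<close>

primrec sp ::
    "('r \<Rightarrow> 'a list) \<Rightarrow> ('r, 'p, 'v) fm \<Rightarrow> ('r, 'a, 'p, 'v) update \<Rightarrow> ('r, 'p, 'v) fm" where
  "sp S \<Phi> (Ins R avs) =
     (let x = fresh_var \<Phi> in
      FEx x (FAnd (FEq (TTab R) (TUnion (TVar x) (TRow (map snd avs)))) (fm_subst x R \<Phi>)))"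
| "sp S \<Phi> (Del R \<phi>) =
     (let x = fresh_var \<Phi> in
      FEx x (FAnd (FEq (TTab R) (TSel (tpred_subst x R (tr_pred S (PNot \<phi>) (S R))) (TVar x)))
                  (fm_subst x R \<Phi>)))"
| "sp S \<Phi> (Upd R \<phi> a v) =
     (let x = fresh_var \<Phi> in
      FEx x (FAnd (FEq (TTab R)
                    (TUnion (TSel (tpred_subst x R (tr_pred S (PNot \<phi>) (S R))) (TVar x))
                       (TUpd (TSel (tpred_subst x R (tr_pred S \<phi> (S R))) (TVar x))
                          (pos (S R) a) v)))
                  (fm_subst x R \<Phi>)))"
| "sp S \<Phi> (Seq U1 U2) = sp S (sp S \<Phi> U1) U2"

primrec sp_unsubst ::
    "('r \<Rightarrow> 'a list) \<Rightarrow> ('r, 'p, 'v) fm \<Rightarrow> ('r, 'a, 'p, 'v) update \<Rightarrow> ('r, 'p, 'v) fm" where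
  "sp_unsubst S \<Phi> (Ins R avs) =
     (let x = fresh_var \<Phi> in
      FEx x (FAnd (FEq (TTab R) (TUnion (TVar x) (TRow (map snd avs)))) (fm_subst x R \<Phi>)))"
| "sp_unsubst S \<Phi> (Del R \<phi>) =
     (let x = fresh_var \<Phi> in
      FEx x (FAnd (FEq (TTab R) (TSel (tr_pred S (PNot \<phi>) (S R)) (TVar x))) (fm_subst x R \<Phi>)))"
| "sp_unsubst S \<Phi> (Upd R \<phi> a v) =
     (let x = fresh_var \<Phi> in
      FEx x (FAnd (FEq (TTab R)
                    (TUnion (TSel (tr_pred S (PNot \<phi>) (S R)) (TVar x))
                       (TUpd (TSel (tr_pred S \<phi> (S R)) (TVar x)) (pos (S R) a) v)))
                  (fm_subst x R \<Phi>)))"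
| "sp_unsubst S \<Phi> (Seq U1 U2) = sp_unsubst S (sp_unsubst S \<Phi> U1) U2"

primrec not_self_referring :: "('r, 'a, 'p, 'v) update \<Rightarrow> bool" where
  "not_self_referring (Ins R avs) = True"
| "not_self_referring (Del R \<phi>) = (R \<notin> pred_rels \<phi>)"
| "not_self_referring (Upd R \<phi> a v) = (R \<notin> pred_rels \<phi>)"
| "not_self_referring (Seq U1 U2) = (not_self_referring U1 \<and> not_self_referring U2)"

lemma tm_subst_id:
  fixes t :: "('r, 'p, 'v) tm" and \<phi> :: "('r, 'p, 'v) tpred"
  shows "R \<notin> tm_tabs t \<Longrightarrow> tm_subst x R t = t"
    and "R \<notin> tpred_tabs \<phi> \<Longrightarrow> tpred_subst x R \<phi> = \<phi>"
  by (induction t and \<phi>) auto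

lemma tabs_tr:
  fixes Q :: "('r, 'a, 'p, 'v) query" and \<phi> :: "('r, 'a, 'p, 'v) pred"
  shows "tm_tabs (tr_query S Q) = query_rels Q"
    and "tpred_tabs (tr_pred S \<phi> as) = pred_rels \<phi>"
  by (induction Q and \<phi> arbitrary: and as) auto

lemma sp_eq_sp_unsubst:
  "not_self_referring U \<Longrightarrow> sp S \<Phi> U = sp_unsubst S \<Phi> U"
  by (induction U arbitrary: \<Phi>) (auto simp: Let_def tm_subst_id tabs_tr)

lemma sp_unsubst_unsound:
  fixes R :: 'r and a :: 'a and \<sigma> :: "'p \<Rightarrow> 'v::linorder" and c :: 'v
  defines "S \<equiv> \<lambda>_. [a]" and "\<Delta> \<equiv> \<lambda>_. [[a \<mapsto> c]]"
    and "U \<equiv> Del R (PIn a (QRel R))" and "\<Phi> \<equiv> FEq (TTab R) (TRow [Const c])"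
  shows "wf_schema S" "wf_instance S \<Delta>" "wf_update S U" "agrees S \<Delta> \<sigma> \<Phi>"
    and "\<not> agrees S (update_sem S \<sigma> U \<Delta>) \<sigma> (sp_unsubst S \<Phi> U)"
  by (auto simp: assms wf_schema_def wf_instance_def agrees_def tr_instance_def row_of_def
      first_values_def Let_def)

end

theory Submission
  imports Defs
begin

text \<open>On tuples whose domain is the attribute list, passing to rows is injective and commutes with
  every operation on tuples, so the translation of queries and predicates preserves their meaning.
  Substituting a fresh variable \<open>x\<close> for \<open>R\<close> has the same effect as interpreting \<open>R\<close> by the value of
  \<open>x\<close>. Hence the old content of \<open>R\<close> is a witness for the existential quantifier in the strongest
  postcondition.\<close>

section \<open>Substitution of a fresh variable for a table\<close>

lemma finite_vars:
  fixes t :: "('r, 'p, 'v) tm" and \<phi> :: "('r, 'p, 'v) tpred"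
  shows finite_tm_vars: "finite (tm_vars t)"
    and finite_tpred_vars: "finite (tpred_vars \<phi>)"
  by (induction t and \<phi>) auto

lemma finite_fm_vars: "finite (fm_vars F)"
  by (induction F) (auto simp: finite_tm_vars)

lemma fresh_var_notin: "fresh_var F \<notin> fm_vars F"
  unfolding fresh_var_def
  by (rule someI_ex, rule ex_new_if_finite) (auto simp: finite_fm_vars)

lemma subst_sem:
  fixes t :: "('r, 'p, 'v::linorder) tm" and \<phi> :: "('r, 'p, 'v) tpred"
  shows tm_sem_subst: "tm_sem I \<sigma> \<rho> (tm_subst x R t) = tm_sem (I(R := \<rho> x)) \<sigma> \<rho> t"
    and tpred_sem_subst:
      "tpred_sem I \<sigma> \<rho> (tpred_subst x R \<phi>) = tpred_sem (I(R := \<rho> x)) \<sigma> \<rho> \<phi>"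
  by (induction t and \<phi>) auto

text \<open>As \<open>x\<close> differs from every bound variable, relation quantifiers leave
  \<open>\<rho> x\<close> alone, and one modified interpretation serves throughout the
  induction.\<close>

lemma sat_subst:
  "x \<notin> fm_vars F \<Longrightarrow> sat I \<sigma> \<rho> (fm_subst x R F) = sat (I(R := \<rho> x)) \<sigma> \<rho> F"
  by (induction F arbitrary: \<sigma> \<rho>) (auto simp: tm_sem_subst)

section \<open>Tuples and rows\<close>

lemma pos_less: "a \<in> set as \<Longrightarrow> pos as a < length as"
  by (induction as) (auto simp: pos_def)

lemma nth_pos: "a \<in> set as \<Longrightarrow> as ! pos as a = a"
  by (induction as) (auto simp: pos_def)

lemma row_of_nth_pos: "a \<in> set as \<Longrightarrow> row_of as t ! pos as a = the (t a)"
  by (simp add: row_of_def pos_less nth_pos)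

text \<open>Needed for differences, where tuples are compared for equality. The exact domain
  matters: a row shows neither values outside \<open>as\<close> nor whether an attribute in
  \<open>as\<close> is undefined.\<close>

lemma row_of_inj: "inj_on (row_of as) {t. dom t = set as}"
proof (rule inj_onI)
  fix s t assume st: "s \<in> {t. dom t = set as}" "t \<in> {t. dom t = set as}"
    and eq: "row_of as s = row_of as t"
  show "s = t"
  proof
    fix a
    show "s a = t a"
    proof (cases "a \<in> set as")
      case True
      then have "a \<in> dom s" "a \<in> dom t" "the (s a) = the (t a)"
        using st eq by (auto simp: row_of_def)
      then show ?thesis by auto
    next
      case False
      then have "a \<notin> dom s" "a \<notin> dom t"
        using st by auto
      then show ?thesis by (simp add: domIff)
    qed
  qed
qed

lemma row_of_restrict:
  "set \<psi> \<subseteq> set as \<Longrightarrow> row_of \<psi> (t |` set \<psi>) = map (\<lambda>i. row_of as t ! i) (map (pos as) \<psi>)"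
  by (simp add: row_of_def[of \<psi>] row_of_nth_pos subset_iff)

text \<open>\<open>++\<close> prefers its right argument; disjointness protects the values of
  \<open>y\<close>.\<close>

lemma row_of_map_add:
  assumes "dom y = set as" "dom z = set bs" "set as \<inter> set bs = {}"
  shows "row_of (as @ bs) (y ++ z) = row_of as y @ row_of bs z"
proof -
  have "(y ++ z) a = y a" if "a \<in> set as" for a
    using that assms by (intro map_add_dom_app_simps(3)) auto
  moreover have "(y ++ z) b = z b" if "b \<in> set bs" for b
    using that assms by (intro map_add_dom_app_simps(1)) auto
  ultimately show ?thesis by (simp add: row_of_def)
qed

text \<open>Distinctness makes \<open>pos as a\<close> the only position carrying \<open>a\<close>,
  so the tuple update touches a single component.\<close>

lemma row_of_upd:
  assumes "distinct as" "a \<in> set as"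
  shows "row_of as (t(a \<mapsto> v)) = (row_of as t)[pos as a := v]"
proof (rule nth_equalityI)
  fix i assume "i < length (row_of as (t(a \<mapsto> v)))"
  then have i: "i < length as" by (simp add: row_of_def)
  then have "as ! i = a \<longleftrightarrow> i = pos as a"
    using assms by (metis nth_eq_iff_index_eq nth_pos pos_less)
  with i show "row_of as (t(a \<mapsto> v)) ! i = (row_of as t)[pos as a := v] ! i"
    by (auto simp: row_of_def nth_list_update)
qed (simp add: row_of_def)

text \<open>\<open>map_of\<close> sees only the first pair of each key; distinct keys make every
  pair count.\<close>

lemma row_of_map_of:
  assumes "distinct (map fst avs)"
  shows "row_of (map fst avs) (map_of (map (\<lambda>(a, v). (a, f v)) avs)) = map f (map snd avs)"
proof -
  have "map_of (map (\<lambda>(a, v). (a, f v)) avs) a = Some (f v)" if "(a, v) \<in> set avs" for a v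
    using that assms by (intro map_of_is_SomeI) (force simp: comp_def case_prod_unfold)+
  then show ?thesis by (auto simp: row_of_def)
qed

lemma map_fold_remove1:
  assumes "inj_on f A" "set xs \<subseteq> A" "set ys \<subseteq> A"
  shows "map f (fold remove1 ys xs) = fold remove1 (map f ys) (map f xs)"
  using assms(2,3)
proof (induction ys arbitrary: xs)
  case (Cons y ys)
  \<comment> \<open>By injectivity an entry equals \<open>y\<close> exactly when its image equals
    \<open>f y\<close>, so both removals hit the same position.\<close>
  have "map f (remove1 y xs) = remove1 (f y) (map f xs)"
    using Cons.prems inj_on_subset[OF assms(1), of "insert y (set xs)"]
    by (induction xs) (auto simp: inj_on_def)
  moreover have "set (remove1 y xs) \<subseteq> A"
    using Cons.prems set_remove1_subset[of y xs] by blast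
  ultimately show ?case
    using Cons by simp
qed simp

lemma map_list_diff:
  assumes "inj_on f A" "set xs \<subseteq> A" "set ys \<subseteq> A"
  shows "map f (list_diff xs ys) = list_diff (map f xs) (map f ys)"
  using map_fold_remove1[OF assms] by (simp add: list_diff_def)

lemma set_list_diff_subset: "set (list_diff xs ys) \<subseteq> set xs"
  unfolding list_diff_def
proof (induction ys arbitrary: xs)
  case (Cons y ys)
  then show ?case using set_remove1_subset[of y xs] by fastforce
qed simp

lemma map_filter_cong:
  "(\<And>x. x \<in> set xs \<Longrightarrow> P x = Q (f x)) \<Longrightarrow> map f (filter P xs) = filter Q (map f xs)"
  by (induction xs) auto

lemma map_row_of_product:
  assumes "\<And>y. y \<in> set ys \<Longrightarrow> dom y = set as" "\<And>z. z \<in> set zs \<Longrightarrow> dom z = set bs"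
    and "set as \<inter> set bs = {}"
  shows "map (row_of (as @ bs)) [y ++ z. y \<leftarrow> ys, z \<leftarrow> zs] =
    [y @ z. y \<leftarrow> map (row_of as) ys, z \<leftarrow> map (row_of bs) zs]"
  using assms(1)
proof (induction ys)
  case (Cons y ys)
  have "map (row_of (as @ bs)) (map ((++) y) zs) = map ((@) (row_of as y)) (map (row_of bs) zs)"
    using Cons.prems assms(2,3) by (auto simp: row_of_map_add)
  with Cons show ?case by simp
qed simp

section \<open>Correctness of the translation\<close>

text \<open>Supplies the exact domains that \<open>row_of_inj\<close> and
  \<open>row_of_map_add\<close> require of intermediate results.\<close>

lemma dom_query_sem:
  assumes "wf_instance S \<Delta>"
  shows "wf_query S Q \<Longrightarrow> t \<in> set (query_sem S \<sigma> \<Delta> Q) \<Longrightarrow> dom t = set (query_attrs S Q)"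
\<comment> \<open>The claim about predicates is trivial, since filtering creates no new
  tuples.\<close>
proof (induction Q arbitrary: t rule: query.induct[where ?P2.0 = "\<lambda>_. True"])
  case (QRel R)
  then show ?case using assms by (auto simp: wf_instance_def)
next
  case (QProj \<psi> Q)
  then obtain u where "u \<in> set (query_sem S \<sigma> \<Delta> Q)" "t = u |` set \<psi>"
    by auto
  with QProj show ?case by (simp add: Int_absorb1)
next
  case (QJoin \<phi> Q1 Q2)
  then obtain y z where "y \<in> set (query_sem S \<sigma> \<Delta> Q1)" "z \<in> set (query_sem S \<sigma> \<Delta> Q2)" "t = y ++ z"
    by auto
  with QJoin show ?case by (simp add: Un_commute)
next
  case (QUnion Q1 Q2)
  then show ?case by (cases "t \<in> set (query_sem S \<sigma> \<Delta> Q1)") simp_all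
next
  case (QDiff Q1 Q2)
  then show ?case using set_list_diff_subset[of "query_sem S \<sigma> \<Delta> Q1"] by (simp add: subset_iff)
qed auto

text \<open>Both claims go together because selections contain predicates and \<open>PIn\<close>
  contains a query. The tuple \<open>t\<close> is arbitrary: both sides read it only through
  \<open>the (t a)\<close> for \<open>a\<close> in \<open>as\<close>.\<close>

lemma tr_sem:
  fixes Q :: "('r, 'a, 'p, 'v::linorder) query" and \<phi> :: "('r, 'a, 'p, 'v) pred"
  assumes "wf_instance S \<Delta>"
  shows tm_sem_tr_query: "wf_query S Q \<Longrightarrow>
      tm_sem (tr_instance S \<Delta>) \<sigma> \<rho> (tr_query S Q) =
        map (row_of (query_attrs S Q)) (query_sem S \<sigma> \<Delta> Q)"
    and tpred_sem_tr_pred: "wf_pred S \<phi> as \<Longrightarrow>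
      tpred_sem (tr_instance S \<Delta>) \<sigma> \<rho> (tr_pred S \<phi> as) (row_of as t) = pred_sem S \<sigma> \<Delta> \<phi> t"
proof (induction Q and \<phi> arbitrary: and as t)
  case (QRel R)
  then show ?case by (simp add: tr_instance_def)
next
  case (QProj \<psi> Q)
  then show ?case by (simp add: row_of_restrict[of \<psi> "query_attrs S Q"])
next
  case (QSel \<phi> Q)
  then show ?case by (auto intro!: map_filter_cong[symmetric])
next
  case (QJoin \<phi> Q1 Q2)
  then have "tm_sem (tr_instance S \<Delta>) \<sigma> \<rho> (TProd (tr_query S Q1) (tr_query S Q2)) =
      map (row_of (query_attrs S Q1 @ query_attrs S Q2))
        [y ++ z. y \<leftarrow> query_sem S \<sigma> \<Delta> Q1, z \<leftarrow> query_sem S \<sigma> \<Delta> Q2]"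
    by (subst map_row_of_product) (auto simp: dom_query_sem[OF assms])
  with QJoin show ?case
    by (simp del: tm_sem.simps(6) map_concat map_map)
      (rule map_filter_cong[symmetric], simp)
next
  case (QDiff Q1 Q2)
  \<comment> \<open>Equal attribute lists put both operands into one set on which
    \<open>row_of\<close> is injective.\<close>
  then have "set (query_sem S \<sigma> \<Delta> Q1) \<subseteq> {t. dom t = set (query_attrs S Q2)}"
    using dom_query_sem[OF assms, of Q1] by (intro subsetI) simp
  moreover have "set (query_sem S \<sigma> \<Delta> Q2) \<subseteq> {t. dom t = set (query_attrs S Q2)}"
    using QDiff dom_query_sem[OF assms, of Q2] by (intro subsetI) simp
  ultimately have "map (row_of (query_attrs S Q2))
        (list_diff (query_sem S \<sigma> \<Delta> Q1) (query_sem S \<sigma> \<Delta> Q2)) =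
      list_diff (map (row_of (query_attrs S Q2)) (query_sem S \<sigma> \<Delta> Q1))
        (map (row_of (query_attrs S Q2)) (query_sem S \<sigma> \<Delta> Q2))"
    by (rule map_list_diff[OF row_of_inj])
  with QDiff show ?case by simp
qed (simp_all add: row_of_nth_pos)

section \<open>Instances after an update and the common form of postconditions\<close>

lemma wf_instance_fun_upd:
  "wf_instance S \<Delta> \<Longrightarrow> \<forall>t \<in> set ts. dom t = set (S R) \<Longrightarrow> wf_instance S (\<Delta>(R := ts))"
  by (simp add: wf_instance_def)

text \<open>Lets the second statement of a sequence start from an instance over the schema.\<close>

lemma wf_instance_update_sem:
  "wf_update S U \<Longrightarrow> wf_instance S \<Delta> \<Longrightarrow> wf_instance S (update_sem S \<sigma> U \<Delta>)"
proof (induction U arbitrary: \<Delta>)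
  case (Ins R avs)
  have "fst ` (\<lambda>(a, v). (a, veval \<sigma> v)) ` set avs = set (map fst avs)"
    by (force simp: image_iff)
  then have "dom (map_of (map (\<lambda>(a, v). (a, veval \<sigma> v)) avs)) = set (S R)"
    using Ins.prems(1) by (simp add: dom_map_of_conv_image_fst flip: set_map)
  with Ins.prems(2) show ?case
    by (simp add: wf_instance_def)
next
  case (Upd R \<phi> a v)
  from Upd.prems(2) have "dom t = set (S R)" if "t \<in> set (\<Delta> R)" for t
    using that by (simp add: wf_instance_def)
  \<comment> \<open>The assigned attribute is already in the schema, so the domain does not
    grow.\<close>
  moreover have "insert a (set (S R)) = set (S R)"
    using Upd.prems(1) by (simp add: insert_absorb)
  ultimately show ?case
    unfolding update_sem.simps by (intro wf_instance_fun_upd Upd.prems(2)) (simp add: ball_Un)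
next
  case (Del R \<phi>)
  then show ?case by (simp add: wf_instance_def)
qed simp

lemma tr_instance_fun_upd:
  "tr_instance S (\<Delta>(R := ts)) = (tr_instance S \<Delta>)(R := map (row_of (S R)) ts)"
  by (auto simp: tr_instance_def)

text \<open>Common to the three atomic statements, which differ only in \<open>t\<close>. It remains
  to evaluate \<open>t\<close> where \<open>x\<close> holds the old table.\<close>

lemma agrees_postcondition:
  assumes "x \<notin> fm_vars \<Phi>" "agrees S \<Delta> \<sigma> \<Phi>"
    and "\<And>\<rho>. \<rho> x = tr_instance S \<Delta> R \<Longrightarrow>
      tm_sem (tr_instance S (\<Delta>(R := ts))) \<sigma> \<rho> t = map (row_of (S R)) ts"
  shows "agrees S (\<Delta>(R := ts)) \<sigma> (FEx x (FAnd (FEq (TTab R) t) (fm_subst x R \<Phi>)))"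
  unfolding agrees_def
proof
  fix \<rho>
  let ?\<rho> = "\<rho>(x := tr_instance S \<Delta> R)"
  \<comment> \<open>Reading \<open>R\<close> as \<open>x\<close> undoes the update and restores the
    old structure; agreement covers every \<open>\<rho>\<close>, hence also the modified
    one.\<close>
  have "sat (tr_instance S (\<Delta>(R := ts))) \<sigma> ?\<rho> (fm_subst x R \<Phi>)"
    using assms(1,2) by (simp add: sat_subst tr_instance_fun_upd agrees_def)
  moreover have "sat (tr_instance S (\<Delta>(R := ts))) \<sigma> ?\<rho> (FEq (TTab R) t)"
    using assms(3)[of ?\<rho>] by (simp add: tr_instance_fun_upd)
  ultimately show "sat (tr_instance S (\<Delta>(R := ts))) \<sigma> \<rho>
      (FEx x (FAnd (FEq (TTab R) t) (fm_subst x R \<Phi>)))"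
    by (auto simp del: sat.simps(3))
qed

text \<open>The term is evaluated after the update, but the substitution makes subqueries on
  \<open>R\<close> read the old table, as the program does.\<close>

lemma filter_tr_instance:
  assumes "wf_instance S \<Delta>" "wf_pred S \<phi> (S R)" "\<rho> x = tr_instance S \<Delta> R"
  shows "filter (tpred_sem (tr_instance S (\<Delta>(R := ts))) \<sigma> \<rho> (tpred_subst x R (tr_pred S \<phi> (S R))))
      (tr_instance S \<Delta> R) = map (row_of (S R)) (filter (pred_sem S \<sigma> \<Delta> \<phi>) (\<Delta> R))"
proof -
  have "tpred_sem (tr_instance S (\<Delta>(R := ts))) \<sigma> \<rho> (tpred_subst x R (tr_pred S \<phi> (S R))) =
      tpred_sem (tr_instance S \<Delta>) \<sigma> \<rho> (tr_pred S \<phi> (S R))"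
    using assms(3) by (simp add: tpred_sem_subst tr_instance_fun_upd)
  then show ?thesis
    unfolding tr_instance_def[of S \<Delta> R] using assms
    by (intro map_filter_cong[symmetric]) (simp add: tpred_sem_tr_pred)
qed

theorem theorem5p2:
  fixes S :: "'r \<Rightarrow> 'a list"
    and U :: "('r, 'a, 'p, 'v::linorder) update"
    and \<sigma> :: "'p \<Rightarrow> 'v"
    and \<Delta> \<Delta>' :: "('r, 'a, 'v) db"
    and \<Phi> :: "('r, 'p, 'v) fm"
  assumes "wf_schema S"
    and "wf_instance S \<Delta>"
    and "wf_update S U"
    and "update_sem S \<sigma> U \<Delta> = \<Delta>'"
    and "agrees S \<Delta> \<sigma> \<Phi>"
  shows "agrees S \<Delta>' \<sigma> (sp S \<Phi> U)"
  using assms(2-)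
proof (induction U arbitrary: \<Delta> \<Delta>' \<Phi>)
  case (Seq U1 U2)
  \<comment> \<open>The second induction hypothesis is used at the intermediate instance with
    \<open>sp S \<Phi> U1\<close> in place of \<open>\<Phi>\<close>.\<close>
  then show ?case using wf_instance_update_sem by fastforce
next
  case (Ins R avs)
  have "row_of (S R) (map_of (map (\<lambda>(a, v). (a, veval \<sigma> v)) avs)) = map (veval \<sigma>) (map snd avs)"
    using Ins.prems(2) assms(1) row_of_map_of[of avs "veval \<sigma>"] by (simp add: wf_schema_def)
  then show ?case
    unfolding Ins.prems(3)[symmetric] sp.simps update_sem.simps Let_def
    by (intro agrees_postcondition fresh_var_notin Ins.prems(4))
      (simp add: tr_instance_def[of S \<Delta> R])
next
  case (Del R \<phi>)
  \<comment> \<open>A deletion keeps the rows satisfying the negation, so the filter lemma is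
    applied to \<open>PNot \<phi>\<close>.\<close>
  then have "wf_pred S (PNot \<phi>) (S R)" by simp
  note filter_tr_instance[OF Del.prems(1) this]
  then show ?case
    unfolding Del.prems(3)[symmetric] sp.simps update_sem.simps Let_def
    by (intro agrees_postcondition fresh_var_notin Del.prems(4))
      (simp del: tr_pred.simps)
next
  case (Upd R \<phi> a v)
  then have wf: "wf_pred S \<phi> (S R)" "wf_pred S (PNot \<phi>) (S R)" by simp_all
  note filters = wf[THEN filter_tr_instance[OF Upd.prems(1)]]
  have "row_of (S R) (t(a \<mapsto> veval \<sigma> v)) = (row_of (S R) t)[pos (S R) a := veval \<sigma> v]" for t
    using Upd.prems(2) assms(1) by (simp add: row_of_upd wf_schema_def)
  with filters show ?case
    unfolding Upd.prems(3)[symmetric] sp.simps update_sem.simps Let_def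
    by (intro agrees_postcondition fresh_var_notin Upd.prems(4))
      (simp del: tr_pred.simps)
qed

end
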